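(* Let $\mathbb{F}$ be a finite field with $n=|\mathbb{F}|$ elements and $R=M_2(\mathbb{F})$. Then the idempotent graph $I(R)$ is a disjoint union of $\frac{n(n+1)}{2}$ copies of $K_2$.
   Context: For a ring $R$, the idempotent graph $I(R)$ is the simple graph whose vertices are the nontrivial idempotents of $R$ (idempotents other than $0$ and $1$), with distinct vertices $h,k$ adjacent iff $hk=kh=0$. $K_2$ is the complete graph on two vertices. *)

theory Defs
  imports
    "HOL-Library.Cardinality"
    "HOL-Algebra.Ring"
    "Jordan_Normal_Form.Matrix"
    "Graph_Theory.Graph_Theory"
begin

text \<open>
  As in the library, a simple undirected graph is a symmetric loop-free digraph without
  parallel arcs: an edge between \<open>u\<close> and \<open>v\<close> is the pair of arcs \<open>(u, v)\<close>, \<open>(v, u)\<close>.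
\<close>

definition nontrivial_idempotents :: "('a, 'm) ring_scheme \<Rightarrow> 'a set" where
  "nontrivial_idempotents R =
     {e \<in> carrier R. e \<otimes>\<^bsub>R\<^esub> e = e \<and> e \<noteq> \<zero>\<^bsub>R\<^esub> \<and> e \<noteq> \<one>\<^bsub>R\<^esub>}"

definition idempotent_graph :: "('a, 'm) ring_scheme \<Rightarrow> 'a pair_pre_digraph" where
  "idempotent_graph R =
     \<lparr>pverts = nontrivial_idempotents R,
      parcs = {(h, k). h \<in> nontrivial_idempotents R \<and> k \<in> nontrivial_idempotents R \<and> h \<noteq> k \<and>
                       h \<otimes>\<^bsub>R\<^esub> k = \<zero>\<^bsub>R\<^esub> \<and> k \<otimes>\<^bsub>R\<^esub> h = \<zero>\<^bsub>R\<^esub>}\<rparr>"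

definition complete_graph :: "nat \<Rightarrow> nat pair_pre_digraph" where
  "complete_graph n =
     \<lparr>pverts = {..<n}, parcs = {(u, v). u \<in> {..<n} \<and> v \<in> {..<n} \<and> u \<noteq> v}\<rparr>"

lemma complete_digraph_complete_graph: "complete_digraph n (with_proj (complete_graph n))"
  unfolding complete_digraph_pair_def by (simp add: complete_graph_def)

definition disjoint_copies :: "nat \<Rightarrow> 'a pair_pre_digraph \<Rightarrow> (nat \<times> 'a) pair_pre_digraph" where
  "disjoint_copies m G =
     \<lparr>pverts = {..<m} \<times> pverts G,
      parcs = {((i, u), (j, v)). i < m \<and> i = j \<and> (u, v) \<in> parcs G}\<rparr>"

end

theory Submission
  imports Defs
begin

text \<open>
  The nontrivial idempotents of \<open>M\<^sub>2(F)\<close> are the matrices of trace \<open>1\<close> and determinant \<open>0\<close>,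
  so they correspond to the \<open>n (n + 1)\<close> solutions \<open>(a, b, c)\<close> of \<open>b c = a (1 - a)\<close>.
  For such \<open>h\<close>, \<open>k\<close> the off-diagonal entries of \<open>h k + k h\<close> are those of \<open>h + k\<close>. Hence
  \<open>h k = k h = 0\<close> makes \<open>h + k\<close> diagonal, and the diagonal entries of \<open>h k\<close> then force \<open>k = 1 - h\<close>.
  Adjacency is thus the graph of a fixed-point-free involution, i.e. a perfect matching.
\<close>

section \<open>Perfect matchings\<close>

text \<open>An arc here is the pair of its ends, so a vertex bijection \<open>f\<close> that
  preserves and reflects arcs already determines the arc map, namely
  \<open>map_prod f f\<close>.\<close>

lemma digraph_iso_with_projI:
  assumes G: "parcs G \<subseteq> pverts G \<times> pverts G" and H: "parcs H \<subseteq> pverts H \<times> pverts H"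
    and bij: "bij_betw f (pverts G) (pverts H)"
    and arcs: "\<And>u v. u \<in> pverts G \<Longrightarrow> v \<in> pverts G \<Longrightarrow>
      (f u, f v) \<in> parcs H \<longleftrightarrow> (u, v) \<in> parcs G"
  shows "digraph_iso (with_proj G) (with_proj H)"
proof -
  \<comment> \<open>Tail and head stay the projections \<open>fst\<close> and \<open>snd\<close>, so
    that applying \<open>?hom\<close> to \<open>G\<close> gives \<open>H\<close> itself.\<close>
  let ?hom = "\<lparr>iso_verts = f, iso_arcs = map_prod f f, iso_head = snd, iso_tail = fst\<rparr>"
  have inj: "inj_on f (pverts G)" and img: "f ` pverts G = pverts H"
    using bij by (auto simp: bij_betw_def)
  have wf: "wf_digraph (with_proj G)"
    using G by unfold_locales auto
  have inj_arcs: "inj_on (map_prod f f) (parcs G)"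
    using map_prod_inj_on[OF inj inj] G by (rule inj_on_subset)
  have "map_prod f f ` parcs G = parcs H"
  proof
    show "map_prod f f ` parcs G \<subseteq> parcs H"
      using G arcs by auto
    show "parcs H \<subseteq> map_prod f f ` parcs G"
    proof
      fix e assume e: "e \<in> parcs H"
      then have "e \<in> f ` pverts G \<times> f ` pverts G"
        using H img by auto
      then obtain u v where "u \<in> pverts G" "v \<in> pverts G" "e = (f u, f v)"
        by blast
      with e arcs show "e \<in> map_prod f f ` parcs G"
        by (auto intro!: image_eqI[where x = "(u, v)"])
    qed
  qed
  then have "with_proj H = app_iso ?hom (with_proj G)"
    using img by (simp add: with_proj_def app_iso_def)
  moreover have "pre_digraph.digraph_isomorphism (with_proj G) ?hom"
    unfolding pre_digraph.digraph_isomorphism_def using wf inj inj_arcs by simp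
  ultimately show ?thesis
    unfolding digraph_iso_def by blast
qed

text \<open>Induction on \<open>m\<close>: removing an orbit \<open>{x, s x}\<close> leaves an
  \<open>s\<close>-invariant set with two elements fewer. The first component of a label numbers the
  orbit, the second tells its two members apart.\<close>

lemma involution_labelling:
  assumes "finite V" and "card V = 2 * m"
    and "\<And>x. x \<in> V \<Longrightarrow> s x \<in> V" and "\<And>x. x \<in> V \<Longrightarrow> s (s x) = x" and "\<And>x. x \<in> V \<Longrightarrow> s x \<noteq> x"
  shows "\<exists>f. bij_betw f V ({..<m} \<times> {..<2::nat}) \<and> (\<forall>x\<in>V. fst (f (s x)) = fst (f x))"
  using assms
proof (induction m arbitrary: V)
  case 0
  then show ?case by (auto simp: bij_betw_def)
next
  case (Suc m)
  from Suc.prems obtain x where x: "x \<in> V"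
    by fastforce
  define W where "W = V - {x, s x}"
  have sx: "s x \<in> V" "s x \<noteq> x" "s (s x) = x"
    using x Suc.prems by auto
  have V: "V = insert x (insert (s x) W)"
    using x sx by (auto simp: W_def)
  have closed: "s y \<in> W" if "y \<in> W" for y
    using that Suc.prems(3,4) x sx by (metis DiffD1 DiffD2 DiffI W_def insert_iff singletonD)
  have "card W = 2 * m"
    using x sx Suc.prems(1,2) by (simp add: W_def card_Diff_subset)
  with Suc.IH[of W] Suc.prems closed obtain f where
    f: "bij_betw f W ({..<m} \<times> {..<2::nat})" and fs: "\<And>y. y \<in> W \<Longrightarrow> fst (f (s y)) = fst (f y)"
    by (auto simp: W_def)
  \<comment> \<open>The labels on \<open>W\<close> use the indices below \<open>m\<close>, so the
    removed orbit becomes copy number \<open>m\<close>.\<close>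
  define g where "g = f(x := (m, 0), s x := (m, 1))"
  have g_W: "g y = f y" if "y \<in> W" for y
    using that by (auto simp: g_def W_def)
  have g_x: "g x = (m, 0)" "g (s x) = (m, 1)"
    using sx by (auto simp: g_def)
  have "bij_betw g W ({..<m} \<times> {..<2})"
    using f g_W by (simp cong: bij_betw_cong)
  moreover have "bij_betw g {x, s x} {(m, 0), (m, 1)}"
    using g_x by (auto simp: bij_betw_def inj_on_def)
  ultimately have "bij_betw g (W \<union> {x, s x}) ({..<m} \<times> {..<2} \<union> {(m, 0), (m, 1)})"
    by (rule bij_betw_combine) auto
  moreover have "W \<union> {x, s x} = V"
    using V by auto
  moreover have "{..<m} \<times> {..<2} \<union> {(m, 0), (m, 1)} = {..<Suc m} \<times> {..<2::nat}"
    by auto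
  moreover have "\<forall>y\<in>V. fst (g (s y)) = fst (g y)"
    using V g_W g_x fs closed sx by auto
  ultimately show ?case
    by (intro exI[of _ g]) simp
qed

lemma digraph_iso_disjoint_copies_K2:
  assumes fin: "finite (pverts G)" and card: "card (pverts G) = 2 * m"
    and s: "\<And>x. x \<in> pverts G \<Longrightarrow> s x \<in> pverts G" "\<And>x. x \<in> pverts G \<Longrightarrow> s (s x) = x"
      "\<And>x. x \<in> pverts G \<Longrightarrow> s x \<noteq> x"
    and arcs: "parcs G = {(x, y). x \<in> pverts G \<and> y = s x}"
  shows "digraph_iso (with_proj G) (with_proj (disjoint_copies m (complete_graph 2)))"
proof -
  obtain f where f: "bij_betw f (pverts G) ({..<m} \<times> {..<2::nat})"
    and fs: "\<And>x. x \<in> pverts G \<Longrightarrow> fst (f (s x)) = fst (f x)"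
    using involution_labelling[OF fin card s] by blast
  show ?thesis
  proof (rule digraph_iso_with_projI)
    show "parcs G \<subseteq> pverts G \<times> pverts G"
      using arcs s by auto
    show "parcs (disjoint_copies m (complete_graph 2)) \<subseteq>
      pverts (disjoint_copies m (complete_graph 2)) \<times> pverts (disjoint_copies m (complete_graph 2))"
      by (auto simp: disjoint_copies_def complete_graph_def)
    show "bij_betw f (pverts G) (pverts (disjoint_copies m (complete_graph 2)))"
      using f by (simp add: disjoint_copies_def complete_graph_def)
  next
    fix x y assume x: "x \<in> pverts G" and y: "y \<in> pverts G"
    have mem: "f z \<in> {..<m} \<times> {..<2}" if "z \<in> pverts G" for z
      using f that by (auto simp: bij_betw_def)
    have inj: "f z = f w \<longleftrightarrow> z = w" if "z \<in> pverts G" "w \<in> pverts G" for z w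
      using f that by (auto simp: bij_betw_def inj_on_def)
    \<comment> \<open>\<open>x\<close> and \<open>s x\<close> are distinct but lie in the same copy,
      so only the second component can separate them.\<close>
    have snd_s: "snd (f (s x)) \<noteq> snd (f x)"
      using inj[OF s(1)[OF x] x] s(3)[OF x] fs[OF x] by (auto simp: prod_eq_iff)
    have bounds: "fst (f x) < m" "snd (f x) < 2" "snd (f y) < 2" "snd (f (s x)) < 2"
      using mem[OF x] mem[OF y] mem[OF s(1)[OF x]] by (auto simp: mem_Times_iff)
    have "(f x, f y) \<in> parcs (disjoint_copies m (complete_graph 2)) \<longleftrightarrow>
      fst (f x) = fst (f y) \<and> snd (f x) \<noteq> snd (f y)"
      using bounds by (auto simp: disjoint_copies_def complete_graph_def case_prod_unfold)
    \<comment> \<open>Only 0 and 1 occur as second components, so whatever differs from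
      \<open>snd (f x)\<close> equals \<open>snd (f (s x))\<close>.\<close>
    also have "\<dots> \<longleftrightarrow> f y = f (s x)"
      using bounds snd_s fs[OF x] by (auto simp: prod_eq_iff)
    also have "\<dots> \<longleftrightarrow> (x, y) \<in> parcs G"
      using inj[OF y s(1)[OF x]] x arcs by auto
    finally show "(f x, f y) \<in> parcs (disjoint_copies m (complete_graph 2)) \<longleftrightarrow> (x, y) \<in> parcs G" .
  qed
qed

section \<open>Idempotent matrices of order two\<close>

definition mat2 :: "'a \<Rightarrow> 'a \<Rightarrow> 'a \<Rightarrow> 'a \<Rightarrow> 'a mat" where
  "mat2 a b c d = mat 2 2 (\<lambda>(i, j). if i = 0 then if j = 0 then a else b else if j = 0 then c else d)"

lemma mat2_carrier [simp]: "mat2 a b c d \<in> carrier_mat 2 2"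
  by (simp add: mat2_def)

lemma mat2_index [simp]:
  "mat2 a b c d $$ (0, 0) = a" "mat2 a b c d $$ (0, Suc 0) = b"
  "mat2 a b c d $$ (Suc 0, 0) = c" "mat2 a b c d $$ (Suc 0, Suc 0) = d"
  by (simp_all add: mat2_def)

lemma mat2_eq_iff [simp]:
  "mat2 a b c d = mat2 a' b' c' d' \<longleftrightarrow> a = a' \<and> b = b' \<and> c = c' \<and> d = d'"
  by (metis mat2_index)

lemma carrier_mat_2E:
  assumes "A \<in> carrier_mat 2 2"
  obtains a b c d where "A = mat2 a b c d"
proof
  show "A = mat2 (A $$ (0, 0)) (A $$ (0, 1)) (A $$ (1, 0)) (A $$ (1, 1))"
    using assms by (intro eq_matI) (auto simp: mat2_def less_2_cases_iff)
qed

lemma mat2_mult: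
  fixes a :: "'a :: semiring_0"
  shows "mat2 a b c d * mat2 a' b' c' d' =
    mat2 (a * a' + b * c') (a * b' + b * d') (c * a' + d * c') (c * b' + d * d')"
  by (rule eq_matI) (auto simp: mat2_def scalar_prod_def less_2_cases_iff numeral_2_eq_2)

lemma zero_mat_2: "0\<^sub>m 2 2 = mat2 0 0 0 0"
  by (rule eq_matI) (auto simp: mat2_def)

lemma one_mat_2: "1\<^sub>m 2 = mat2 1 0 0 1"
  by (rule eq_matI) (auto simp: mat2_def less_2_cases_iff)

text \<open>The off-diagonal entries of \<open>h * h - h\<close>, and the difference of its diagonal
  entries, are \<open>b\<close>, \<open>c\<close> and \<open>a - d\<close> times
  \<open>a + d - 1\<close>. Without zero divisors, either the trace is 1 or \<open>h\<close> is
  scalar; a scalar idempotent is trivial.\<close>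

lemma mat2_idempotent_nontrivial_iff:
  fixes a :: "'a :: idom"
  shows "mat2 a b c d * mat2 a b c d = mat2 a b c d \<and> mat2 a b c d \<noteq> 0\<^sub>m 2 2 \<and> mat2 a b c d \<noteq> 1\<^sub>m 2
    \<longleftrightarrow> d = 1 - a \<and> b * c = a * (1 - a)"
    (is "?L \<longleftrightarrow> ?R")
proof
  assume ?L
  then have eqs: "a * a + b * c = a" "a * b + b * d = b" "c * a + d * c = c" "c * b + d * d = d"
    and nz: "\<not> (a = 0 \<and> b = 0 \<and> c = 0 \<and> d = 0)" "\<not> (a = 1 \<and> b = 0 \<and> c = 0 \<and> d = 1)"
    by (simp_all add: mat2_mult zero_mat_2 one_mat_2)
  have "b * (a + d - 1) = (a * b + b * d) - b" "c * (a + d - 1) = (c * a + d * c) - c"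
    "(a - d) * (a + d - 1) = (a * a + b * c) - (c * b + d * d) - (a - d)"
    by (simp_all add: algebra_simps)
  then have "b * (a + d - 1) = 0" "c * (a + d - 1) = 0" "(a - d) * (a + d - 1) = 0"
    using eqs by simp_all
  then have "a + d - 1 = 0 \<or> (b = 0 \<and> c = 0 \<and> a = d)"
    by auto
  moreover have False if "b = 0 \<and> c = 0 \<and> a = d"
  proof -
    have "a * (a - 1) = 0"
      using eqs(1) that by (simp add: algebra_simps)
    with that nz show False by auto
  qed
  ultimately have "d = 1 - a"
    by (auto simp: algebra_simps)
  with eqs(1) show ?R
    by (auto simp: algebra_simps)
next
  assume R: ?R
  moreover have "a * a + b * c = a" "c * b + (1 - a) * (1 - a) = 1 - a"
    using R by (simp_all add: algebra_simps)
  ultimately show ?L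
    by (auto simp: mat2_mult zero_mat_2 one_mat_2) (simp_all add: algebra_simps)
qed

lemma nontrivial_idempotents_mat_2:
  "nontrivial_idempotents (ring_mat TYPE('a :: idom) 2 u) =
    (\<lambda>(a, b, c). mat2 a b c (1 - a)) ` {(a, b, c). b * c = a * (1 - a)}"
proof (rule Set.set_eqI)
  fix A :: "'a mat"
  show "A \<in> nontrivial_idempotents (ring_mat TYPE('a) 2 u) \<longleftrightarrow>
    A \<in> (\<lambda>(a, b, c). mat2 a b c (1 - a)) ` {(a, b, c). b * c = a * (1 - a)}"
  proof (cases "A \<in> carrier_mat 2 2")
    case True
    then obtain a b c d where A: "A = mat2 a b c d"
      by (rule carrier_mat_2E)
    have "A \<in> nontrivial_idempotents (ring_mat TYPE('a) 2 u) \<longleftrightarrow> d = 1 - a \<and> b * c = a * (1 - a)"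
      unfolding mat2_idempotent_nontrivial_iff[symmetric]
      by (simp add: A nontrivial_idempotents_def ring_mat_simps)
    also have "\<dots> \<longleftrightarrow> A \<in> (\<lambda>(a, b, c). mat2 a b c (1 - a)) ` {(a, b, c). b * c = a * (1 - a)}"
      by (auto simp: A image_iff)
    finally show ?thesis .
  next
    case False
    then show ?thesis
      by (auto simp: nontrivial_idempotents_def ring_mat_simps)
  qed
qed

text \<open>The solutions of \<open>b * c = a * (1 - a)\<close> are split by \<open>b\<close>. If
  \<open>b\<close> is nonzero, \<open>a\<close> is free and \<open>c\<close> is determined by
  division; if \<open>b = 0\<close>, then \<open>a\<close> is 0 or 1 and \<open>c\<close> is
  free.\<close>

lemma card_nontrivial_idempotents_mat_2:
  "card (nontrivial_idempotents (ring_mat TYPE('a :: {field, finite}) 2 u)) =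
    CARD('a) * (CARD('a) + 1)"
proof -
  let ?n = "CARD('a)"
  let ?S = "{(a :: 'a, b, c). b * c = a * (1 - a)}"
  let ?g = "\<lambda>(a :: 'a, b). (a, b, a * (1 - a) / b)"
  let ?X = "?g ` (UNIV \<times> (UNIV - {0}))" and ?Y = "{0, 1 :: 'a} \<times> {0 :: 'a} \<times> (UNIV :: 'a set)"
  have "?S = ?X \<union> ?Y"
  proof (intro Set.set_eqI iffI)
    fix t assume "t \<in> ?S"
    then obtain a b c where t: "t = (a, b, c)" "b * c = a * (1 - a)"
      by auto
    show "t \<in> ?X \<union> ?Y"
    proof (cases "b = 0")
      case False
      then have "t = ?g (a, b)"
        using t by (simp add: field_simps)
      with False show ?thesis by blast
    qed (use t in auto)
  next
    fix t assume "t \<in> ?X \<union> ?Y"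
    then show "t \<in> ?S"
      by (elim UnE imageE) (auto split: if_splits)
  qed
  moreover have "card ?X = ?n * (?n - 1)"
    by (subst card_image) (auto simp: inj_on_def card_cartesian_product card_Diff_subset)
  moreover have "card ?Y = 2 * ?n"
    by (simp add: card_cartesian_product)
  moreover have "card (?X \<union> ?Y) = card ?X + card ?Y"
    by (rule card_Un_disjoint) auto
  ultimately have "card ?S = ?n * (?n - 1) + 2 * ?n"
    by simp
  \<comment> \<open>Subtraction on naturals is truncated, hence the case split on
    \<open>?n\<close>.\<close>
  moreover have "?n * (?n - 1) + 2 * ?n = ?n * (?n + 1)"
    by (cases ?n) auto
  moreover have "inj_on (\<lambda>(a, b, c). mat2 a b c (1 - a)) ?S"
    by (auto simp: inj_on_def)
  ultimately show ?thesis
    by (simp add: nontrivial_idempotents_mat_2 card_image)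
qed

lemma one_minus_mat2:
  fixes a :: "'a :: ring_1"
  shows "1\<^sub>m 2 - mat2 a b c d = mat2 (1 - a) (- b) (- c) (1 - d)"
  by (rule eq_matI) (auto simp: mat2_def less_2_cases_iff)

lemma mat2_orthogonal_idempotents_iff:
  fixes a :: "'a :: idom"
  assumes e: "b * c = a * (1 - a)"
  shows "mat2 a b c (1 - a) * mat2 a' b' c' (1 - a') = 0\<^sub>m 2 2 \<and>
      mat2 a' b' c' (1 - a') * mat2 a b c (1 - a) = 0\<^sub>m 2 2 \<longleftrightarrow>
    a' = 1 - a \<and> b' = - b \<and> c' = - c"
    (is "?L \<longleftrightarrow> ?R")
proof
  assume ?L
  then have eqs: "a * a' + b * c' = 0" "a * b' + b * (1 - a') = 0" "c * a' + (1 - a) * c' = 0"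
    "c * b' + (1 - a) * (1 - a') = 0" "a' * b + b' * (1 - a) = 0" "c' * a + (1 - a') * c = 0"
    by (simp_all add: mat2_mult zero_mat_2)
  have "b + b' = (a * b' + b * (1 - a')) + (a' * b + b' * (1 - a))"
    "c + c' = (c * a' + (1 - a) * c') + (c' * a + (1 - a') * c)"
    by (simp_all add: algebra_simps)
  then have "b + b' = 0" "c + c' = 0"
    using eqs by simp_all
  then have b': "b' = - b" and c': "c' = - c"
    by (simp_all add: eq_neg_iff_add_eq_0 add.commute)
  \<comment> \<open>Splitting 1 as \<open>a + (1 - a)\<close> avoids dividing by \<open>a\<close>:
    the first summand is governed by the upper left entry of the product, the second by the lower
    right one, both up to the defect \<open>b * c - a * (1 - a)\<close>, which vanishes by
    \<open>e\<close>.\<close>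
  have "a + a' - 1 = a * (a + a' - 1) + (1 - a) * (a + a' - 1)"
    by (simp add: algebra_simps)
  also have "a * (a + a' - 1) = (a * a' + b * c') + (b * c - a * (1 - a))"
    by (simp add: c' algebra_simps)
  also have "(1 - a) * (a + a' - 1) = - (c * b' + (1 - a) * (1 - a')) - (b * c - a * (1 - a))"
    by (simp add: b' algebra_simps)
  finally have "a + a' - 1 = 0"
    using eqs e by simp
  with b' c' show ?R
    by (auto simp: algebra_simps)
next
  assume ?R
  then have R: "a' = 1 - a" "b' = - b" "c' = - c"
    by simp_all
  show ?L
    unfolding R using e by (auto simp: mat2_mult zero_mat_2 algebra_simps)
qed

theorem theorem3p7:
  fixes n :: nat
  assumes "n = CARD('a :: {field, finite})"
  shows "digraph_iso
           (with_proj (idempotent_graph (ring_mat TYPE('a) 2 ())))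
           (with_proj (disjoint_copies (n * (n + 1) div 2) (complete_graph 2)))"
proof (rule digraph_iso_disjoint_copies_K2)
  let ?R = "ring_mat TYPE('a) 2 ()"
  let ?G = "idempotent_graph ?R"
  let ?s = "\<lambda>A :: 'a mat. 1\<^sub>m 2 - A"
  have verts: "pverts ?G = (\<lambda>(a, b, c). mat2 a b c (1 - a)) ` {(a, b, c). b * c = a * (1 - a)}"
    by (simp add: idempotent_graph_def nontrivial_idempotents_mat_2)
  show "finite (pverts ?G)"
    unfolding verts by simp
  \<comment> \<open>\<open>n * (n + 1)\<close> is even, so \<open>div\<close> loses nothing.\<close>
  show "card (pverts ?G) = 2 * (n * (n + 1) div 2)"
    by (simp add: idempotent_graph_def card_nontrivial_idempotents_mat_2 assms)
  show s_verts: "?s A \<in> pverts ?G" if "A \<in> pverts ?G" for A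
  proof -
    from that obtain a b c where "A = mat2 a b c (1 - a)" and "b * c = a * (1 - a)"
      unfolding verts by auto
    \<comment> \<open>Passing to \<open>1 - A\<close> swaps the factors \<open>a\<close> and
      \<open>1 - a\<close> and negates both \<open>b\<close> and \<open>c\<close>, so the equation
      is preserved.\<close>
    then show ?thesis
      unfolding verts
      by (intro image_eqI[where x = "(1 - a, - b, - c)"]) (auto simp: one_minus_mat2 mult.commute)
  qed
  show "?s (?s A) = A" if "A \<in> pverts ?G" for A
    using that unfolding verts by (auto simp: one_minus_mat2)
  have orth: "A * B = 0\<^sub>m 2 2 \<and> B * A = 0\<^sub>m 2 2 \<longleftrightarrow> B = ?s A"
    if "A \<in> pverts ?G" "B \<in> pverts ?G" for A B
  proof -
    from that obtain a b c a' b' c' where A: "A = mat2 a b c (1 - a)" "b * c = a * (1 - a)"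
      and B: "B = mat2 a' b' c' (1 - a')"
      unfolding verts by auto
    show ?thesis
      unfolding A(1) B mat2_orthogonal_idempotents_iff[OF A(2)] one_minus_mat2 by auto
  qed
  \<comment> \<open>If \<open>?s A = A\<close>, then \<open>orth\<close> gives
    \<open>A * A = 0\<close>, whereas \<open>A * A = A\<close> is nonzero. This argument also covers
    characteristic 2.\<close>
  show s_neq: "?s A \<noteq> A" if "A \<in> pverts ?G" for A
    using orth[OF that that] that
    by (auto simp: idempotent_graph_def nontrivial_idempotents_def ring_mat_simps)
  show "parcs ?G = {(A, B). A \<in> pverts ?G \<and> B = ?s A}"
  proof -
    have "parcs ?G = {(A, B). A \<in> pverts ?G \<and> B \<in> pverts ?G \<and> A \<noteq> B \<and>
        A * B = 0\<^sub>m 2 2 \<and> B * A = 0\<^sub>m 2 2}"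
      by (simp add: idempotent_graph_def ring_mat_simps)
    also have "\<dots> = {(A, B). A \<in> pverts ?G \<and> B = ?s A}"
      using orth s_verts s_neq by (auto dest: sym)
    finally show ?thesis .
  qed
qed

end
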